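(* Let $\mathcal U$ be an ultrafilter on $[0,1]$, and let $\mathbf{CTNorm}_{\mathcal U}$ be the discrete category whose objects are the $\sim_{\mathcal U}$-equivalence classes $[T]$ of the operations $T\in\mathscr C=\{T_G,T_L,T_P,T_{NM},T_D\}$. (1) If $\mathcal U$ is non-principal and concentrated near $1$, then $\mathbf{CTNorm}_{\mathcal U}$ is isomorphic, as a discrete category, to the discrete category with exactly four distinct objects $\mathsf{Min},\mathsf{Lin},\mathsf{Prod},\mathsf{Dr}$, where $\mathsf{Min}$ corresponds to the class $[T_G]=[T_{NM}]$, and $\mathsf{Lin},\mathsf{Prod},\mathsf{Dr}$ correspond to $[T_L],[T_P],[T_D]$, respectively. (2) If $\mathcal U$ is non-principal and concentrated near $0$, then $\mathbf{CTNorm}_{\mathcal U}$ is isomorphic, as a discrete category, to the discrete category with exactly three distinct objects $\mathsf{Zero},\mathsf{Min},\mathsf{Prod}$, where $\mathsf{Zero}$ corresponds to the class $[T_L]=[T_{NM}]=[T_D]$, and $\mathsf{Min},\mathsf{Prod}$ correspond to $[T_G],[T_P]$, respectively. In particular, for every ultrafilter $\mathcal U$ on $[0,1]$, the category $\mathbf{CTNorm}_{\mathcal U}$ is finite and has at most five objects.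
   Context: The five operations $[0,1]^2\to[0,1]$ are: $T_G(x,y)=\min\{x,y\}$; $T_L(x,y)=\max\{0,x+y-1\}$; $T_P(x,y)=xy$; $T_{NM}(x,y)=\min\{x,y\}$ if $x+y>1$ and $0$ if $x+y\le 1$; $T_D(x,y)=\min\{x,y\}$ if $\max\{x,y\}=1$ and $0$ if $\max\{x,y\}<1$. For an ultrafilter $\mathcal U$ on $[0,1]$ and binary operations $S,T:[0,1]^2\to[0,1]$, write $S\sim_{\mathcal U}T$ if there is $A\in\mathcal U$ with $S(x,y)=T(x,y)$ for all $(x,y)\in A\times A$; this is an equivalence relation, and $[T]$ denotes the class of $T$ in $\mathscr C$. $\mathcal U$ is concentrated near $1$ (resp. near $0$) if every relative neighbourhood of $1$ (resp. $0$) in $[0,1]$ belongs to $\mathcal U$. It is non-principal near $1$ (resp. near $0$), also phrased "non-principal and concentrated near $1$ (resp. $0$)", if it is concentrated near $1$ (resp. $0$) and $\{1\}\notin\mathcal U$ (resp. $\{0\}\notin\mathcal U$). In $\mathbf{CTNorm}_{\mathcal U}$, $\operatorname{Hom}([S],[T])=\{\mathrm{id}_{[S]}\}$ if $[S]=[T]$ and $\varnothing$ otherwise. The symbols $\mathsf{Min},\mathsf{Lin},\mathsf{Prod},\mathsf{Dr},\mathsf{Zero}$ are pairwise distinct formal labels. *)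

theory Defs
  imports "HOL-Analysis.Analysis"
begin

definition ultrafilter_on :: "'a set \<Rightarrow> 'a set set \<Rightarrow> bool" where
  "ultrafilter_on X U \<longleftrightarrow>
     U \<subseteq> Pow X \<and> X \<in> U \<and> {} \<notin> U \<and>
     (\<forall>A\<in>U. \<forall>B\<in>U. A \<inter> B \<in> U) \<and>
     (\<forall>A\<in>U. \<forall>B. A \<subseteq> B \<and> B \<subseteq> X \<longrightarrow> B \<in> U) \<and>
     (\<forall>A. A \<subseteq> X \<longrightarrow> A \<in> U \<or> X - A \<in> U)"

abbreviation unit_interval :: "real set" where
  "unit_interval \<equiv> {0..1}"

definition concentrated_near :: "real \<Rightarrow> real set set \<Rightarrow> bool" where
  "concentrated_near c U \<longleftrightarrow>
     (\<forall>N \<subseteq> unit_interval.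
        (\<exists>V. openin (top_of_set unit_interval) V \<and> c \<in> V \<and> V \<subseteq> N) \<longrightarrow> N \<in> U)"

definition nonprincipal_near :: "real \<Rightarrow> real set set \<Rightarrow> bool" where
  "nonprincipal_near c U \<longleftrightarrow> concentrated_near c U \<and> {c} \<notin> U"

text \<open>Operations on the unit interval are extensional functions on the square, so that
  equality in HOL is equality of operations.\<close>

type_synonym operation = "real \<times> real \<Rightarrow> real"

definition unit_operations :: "operation set" where
  "unit_operations = unit_interval \<times> unit_interval \<rightarrow>\<^sub>E unit_interval"

definition T_G :: operation where
  "T_G = (\<lambda>(x, y)\<in>unit_interval \<times> unit_interval. min x y)"

definition T_L :: operation where
  "T_L = (\<lambda>(x, y)\<in>unit_interval \<times> unit_interval. max 0 (x + y - 1))"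

definition T_P :: operation where
  "T_P = (\<lambda>(x, y)\<in>unit_interval \<times> unit_interval. x * y)"

definition T_NM :: operation where
  "T_NM = (\<lambda>(x, y)\<in>unit_interval \<times> unit_interval. if x + y > 1 then min x y else 0)"

definition T_D :: operation where
  "T_D = (\<lambda>(x, y)\<in>unit_interval \<times> unit_interval. if max x y = 1 then min x y else 0)"

definition CT :: "operation set" where
  "CT = {T_G, T_L, T_P, T_NM, T_D}"

lemma CT_subset_unit_operations: "CT \<subseteq> unit_operations"
  by (auto simp: CT_def unit_operations_def T_G_def T_L_def T_P_def T_NM_def T_D_def
      mult_le_one)

definition sim :: "real set set \<Rightarrow> (operation \<times> operation) set" where
  "sim U = {(S, T). S \<in> unit_operations \<and> T \<in> unit_operations \<and>
              (\<exists>A\<in>U. \<forall>(x, y)\<in>A \<times> A. S (x, y) = T (x, y))}"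

lemma equiv_sim:
  assumes "ultrafilter_on unit_interval U"
  shows "equiv unit_operations (sim U)"
proof (rule equivI)
  show "sim U \<subseteq> unit_operations \<times> unit_operations"
    by (auto simp: sim_def)
  show "refl_on unit_operations (sim U)"
    using assms by (auto simp: refl_on_def sim_def ultrafilter_on_def)
  show "sym (sim U)"
    by (force simp: sym_def sim_def)
  show "trans (sim U)"
  proof (rule transI)
    fix R S T assume "(R, S) \<in> sim U" "(S, T) \<in> sim U"
    then obtain A B where AB: "A \<in> U" "B \<in> U"
      "\<forall>(x, y)\<in>A \<times> A. R (x, y) = S (x, y)" "\<forall>(x, y)\<in>B \<times> B. S (x, y) = T (x, y)"
      and mem: "R \<in> unit_operations" "T \<in> unit_operations"
      by (auto simp: sim_def)
    then have "A \<inter> B \<in> U" "\<forall>(x, y)\<in>(A \<inter> B) \<times> (A \<inter> B). R (x, y) = T (x, y)"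
      using assms by (auto simp: ultrafilter_on_def)
    with mem show "(R, T) \<in> sim U" by (auto simp: sim_def)
  qed
qed

text \<open>The class of \<open>T\<close> is taken inside \<open>CT\<close>, not among all operations.\<close>

definition sim_CT :: "real set set \<Rightarrow> (operation \<times> operation) set" where
  "sim_CT U = sim U \<inter> CT \<times> CT"

definition cls :: "real set set \<Rightarrow> operation \<Rightarrow> operation set" where
  "cls U T = sim_CT U `` {T}"

record ('o, 'a) cat =
  Ob :: "'o set"
  Hom :: "'o \<Rightarrow> 'o \<Rightarrow> 'a set"
  Id :: "'o \<Rightarrow> 'a"
  Comp :: "'a \<Rightarrow> 'a \<Rightarrow> 'a"

text \<open>Hom-sets are pairwise disjoint, so an arrow determines its endpoints; \<open>Comp C g f\<close> is
  \<open>g\<close> after \<open>f\<close>.  Values at non-objects and at non-composable arrows are irrelevant.\<close>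

definition category :: "('o, 'a) cat \<Rightarrow> bool" where
  "category C \<longleftrightarrow>
     (\<forall>x\<in>Ob C. \<forall>y\<in>Ob C. \<forall>x'\<in>Ob C. \<forall>y'\<in>Ob C.
        Hom C x y \<inter> Hom C x' y' \<noteq> {} \<longrightarrow> x = x' \<and> y = y') \<and>
     (\<forall>x\<in>Ob C. Id C x \<in> Hom C x x) \<and>
     (\<forall>x\<in>Ob C. \<forall>y\<in>Ob C. \<forall>z\<in>Ob C. \<forall>f\<in>Hom C x y. \<forall>g\<in>Hom C y z.
        Comp C g f \<in> Hom C x z) \<and>
     (\<forall>x\<in>Ob C. \<forall>y\<in>Ob C. \<forall>f\<in>Hom C x y.
        Comp C f (Id C x) = f \<and> Comp C (Id C y) f = f) \<and>
     (\<forall>w\<in>Ob C. \<forall>x\<in>Ob C. \<forall>y\<in>Ob C. \<forall>z\<in>Ob C.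
        \<forall>f\<in>Hom C w x. \<forall>g\<in>Hom C x y. \<forall>h\<in>Hom C y z.
          Comp C h (Comp C g f) = Comp C (Comp C h g) f)"

definition arrows :: "('o, 'a) cat \<Rightarrow> 'a set" where
  "arrows C = (\<Union>x\<in>Ob C. \<Union>y\<in>Ob C. Hom C x y)"

definition finite_category :: "('o, 'a) cat \<Rightarrow> bool" where
  "finite_category C \<longleftrightarrow> category C \<and> finite (Ob C) \<and> finite (arrows C)"

definition is_functor ::
  "('o, 'a) cat \<Rightarrow> ('p, 'b) cat \<Rightarrow> ('o \<Rightarrow> 'p) \<Rightarrow> ('a \<Rightarrow> 'b) \<Rightarrow> bool" where
  "is_functor C D Fo Fa \<longleftrightarrow>
     category C \<and> category D \<and>
     (\<forall>x\<in>Ob C. Fo x \<in> Ob D) \<and>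
     (\<forall>x\<in>Ob C. \<forall>y\<in>Ob C. \<forall>f\<in>Hom C x y. Fa f \<in> Hom D (Fo x) (Fo y)) \<and>
     (\<forall>x\<in>Ob C. Fa (Id C x) = Id D (Fo x)) \<and>
     (\<forall>x\<in>Ob C. \<forall>y\<in>Ob C. \<forall>z\<in>Ob C. \<forall>f\<in>Hom C x y. \<forall>g\<in>Hom C y z.
        Fa (Comp C g f) = Comp D (Fa g) (Fa f))"

definition cat_isomorphism ::
  "('o, 'a) cat \<Rightarrow> ('p, 'b) cat \<Rightarrow> ('o \<Rightarrow> 'p) \<Rightarrow> ('a \<Rightarrow> 'b) \<Rightarrow> bool" where
  "cat_isomorphism C D Fo Fa \<longleftrightarrow>
     is_functor C D Fo Fa \<and>
     (\<exists>Go Ga. is_functor D C Go Ga \<and>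
        (\<forall>x\<in>Ob C. Go (Fo x) = x) \<and> (\<forall>f\<in>arrows C. Ga (Fa f) = f) \<and>
        (\<forall>y\<in>Ob D. Fo (Go y) = y) \<and> (\<forall>g\<in>arrows D. Fa (Ga g) = g))"

text \<open>In the discrete category on \<open>X\<close> the only arrows are the formal identities \<open>Ident x\<close>.\<close>

datatype 'o ident = Ident 'o

definition discrete_category :: "'o set \<Rightarrow> ('o, 'o ident) cat" where
  "discrete_category X =
     \<lparr> Ob = X,
       Hom = (\<lambda>x y. if x \<in> X \<and> x = y then {Ident x} else {}),
       Id = Ident,
       Comp = (\<lambda>g f. g) \<rparr>"

lemma category_discrete_category: "category (discrete_category X)"
  by (auto simp: category_def discrete_category_def split: if_splits)

definition CTNorm :: "real set set \<Rightarrow> (operation set, operation set ident) cat" where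
  "CTNorm U = discrete_category (CT // sim_CT U)"

datatype label = Min_label | Lin_label | Prod_label | Dr_label | Zero_label

end

theory Submission
  imports Defs
begin

text \<open>
  Everything is decided on the diagonal and on small neighbourhoods of the endpoint. An
  ultrafilter that is non-principal near \<open>c\<close> contains every punctured neighbourhood of \<open>c\<close>
  (\<open>punctured_neighbourhood_in_ultrafilter\<close>). Two operations that agree on the square of
  such a neighbourhood are therefore identified, while two operations whose diagonals
  disagree at every point of it are not (\<open>cls_neqI\<close>), because each member of the ultrafilter
  meets the neighbourhood.

  For \<open>1/2 < x, y\<close> the sum \<open>x + y\<close> exceeds \<open>1\<close>, so \<open>T_NM\<close> is the minimum; the remaining
  diagonals are separated for \<open>1/2 < x < 1\<close> by \<open>x > x\<^sup>2 > 2x - 1 > 0\<close>. For \<open>x, y < 1/2\<close> both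
  \<open>x + y\<close> and \<open>max x y\<close> stay below \<open>1\<close>, so \<open>T_L\<close>, \<open>T_NM\<close> and \<open>T_D\<close> all vanish, and \<open>0 < x\<^sup>2 < x\<close> separates
  the other diagonals.

  A discrete category is determined up to isomorphism by the cardinality of its set of objects
  (\<open>cat_isomorphism_discrete_category\<close>), so it is enough to label the classes bijectively.
  The bound of five holds for any ultrafilter, as the objects are the images of five operations.
\<close>

section \<open>Discrete categories\<close>

text \<open>All arrows are identities, so a map of objects extends to arrows in only one way; the
  inverse functor comes in the same way from the inverse bijection.\<close>

lemma is_functor_discrete_category:
  assumes "F ` X \<subseteq> Y"
  shows "is_functor (discrete_category X) (discrete_category Y) F (map_ident F)"
  using assms unfolding is_functor_def
  by (intro conjI category_discrete_category)
    (auto simp: discrete_category_def split: if_splits)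

lemma arrows_discrete_category: "arrows (discrete_category X) = Ident ` X"
  by (auto simp: arrows_def discrete_category_def split: if_splits)

lemma cat_isomorphism_discrete_category:
  assumes "bij_betw F X Y"
  shows "cat_isomorphism (discrete_category X) (discrete_category Y) F (map_ident F)"
proof -
  let ?G = "inv_into X F"
  have GF: "\<forall>x\<in>X. ?G (F x) = x" and FG: "\<forall>y\<in>Y. F (?G y) = y"
    using assms by (auto simp: bij_betw_inv_into_left bij_betw_inv_into_right)
  have "is_functor (discrete_category X) (discrete_category Y) F (map_ident F)"
    using assms by (intro is_functor_discrete_category) (simp add: bij_betw_imp_surj_on)
  moreover have "is_functor (discrete_category Y) (discrete_category X) ?G (map_ident ?G)"
    using bij_betw_inv_into[OF assms]
    by (intro is_functor_discrete_category) (simp add: bij_betw_imp_surj_on)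
  ultimately show ?thesis
    using GF FG unfolding cat_isomorphism_def arrows_discrete_category
    by (intro conjI exI[of _ ?G] exI[of _ "map_ident ?G"])
      (auto simp: discrete_category_def)
qed

lemma finite_category_discrete_category:
  assumes "finite X"
  shows "finite_category (discrete_category X)"
  using assms
  by (simp add: finite_category_def category_discrete_category arrows_discrete_category)
    (simp add: discrete_category_def)

section \<open>Classes of operations\<close>

lemma CT_quotient: "CT // sim_CT U = cls U ` CT"
  by (auto simp: quotient_def cls_def)

lemma Ob_CTNorm: "Ob (CTNorm U) = cls U ` CT"
  by (simp add: CTNorm_def discrete_category_def CT_quotient)

lemma cls_eq_iff:
  assumes "ultrafilter_on unit_interval U" "S \<in> CT" "T \<in> CT"
  shows "cls U S = cls U T \<longleftrightarrow> (\<exists>A\<in>U. \<forall>x\<in>A. \<forall>y\<in>A. S (x, y) = T (x, y))"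
proof -
  have "equiv CT (sim_CT U)"
    using equiv_sim[OF assms(1)] CT_subset_unit_operations
    unfolding sim_CT_def equiv_def refl_on_def sym_def trans_def by blast
  then have "cls U S = cls U T \<longleftrightarrow> (S, T) \<in> sim_CT U"
    unfolding cls_def using assms(2,3) by (rule eq_equiv_class_iff)
  then show ?thesis
    using assms(2,3) CT_subset_unit_operations by (auto simp: sim_CT_def sim_def)
qed

text \<open>A member of the ultrafilter on whose square the operations agree would meet \<open>A\<close>, and
  a common point \<open>x\<close> gives agreement at \<open>(x, x)\<close>.\<close>

lemma cls_neqI:
  assumes U: "ultrafilter_on unit_interval U" and "S \<in> CT" "T \<in> CT"
    and A: "A \<in> U" and neq: "\<And>x. x \<in> A \<Longrightarrow> S (x, x) \<noteq> T (x, x)"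
  shows "cls U S \<noteq> cls U T"
proof
  assume "cls U S = cls U T"
  then obtain B where B: "B \<in> U" "\<forall>x\<in>B. \<forall>y\<in>B. S (x, y) = T (x, y)"
    using cls_eq_iff assms(1-3) by blast
  have "A \<inter> B \<noteq> {}"
    using U A B(1) unfolding ultrafilter_on_def by metis
  with B(2) neq show False by blast
qed

text \<open>Maximality of the ultrafilter turns \<open>{c} \<notin> U\<close> into the membership of the complement of
  \<open>{c}\<close>, which is then intersected with a ball around \<open>c\<close>.\<close>

lemma punctured_neighbourhood_in_ultrafilter:
  assumes U: "ultrafilter_on unit_interval U" and c: "nonprincipal_near c U"
    and "c \<in> unit_interval" "0 < e"
  shows "{x \<in> unit_interval. x \<noteq> c \<and> \<bar>x - c\<bar> < e} \<in> U"
proof -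
  let ?V = "unit_interval \<inter> ball c e"
  have "openin (top_of_set unit_interval) ?V" "c \<in> ?V"
    using assms(3,4) by auto
  then have "?V \<in> U"
    using c unfolding nonprincipal_near_def concentrated_near_def by blast
  moreover have "unit_interval - {c} \<in> U"
  proof -
    have "{c} \<subseteq> unit_interval" using assms(3) by simp
    then have "{c} \<in> U \<or> unit_interval - {c} \<in> U"
      using U unfolding ultrafilter_on_def by blast
    then show ?thesis using c by (simp add: nonprincipal_near_def)
  qed
  ultimately have "?V \<inter> (unit_interval - {c}) \<in> U"
    using U unfolding ultrafilter_on_def by blast
  moreover have "?V \<inter> (unit_interval - {c}) = {x \<in> unit_interval. x \<noteq> c \<and> \<bar>x - c\<bar> < e}"
    by (auto simp: dist_real_def)
  ultimately show ?thesis by simp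
qed

lemmas operation_defs = T_G_def T_L_def T_P_def T_NM_def T_D_def

section \<open>The two endpoints\<close>

lemma classes_near_1:
  assumes U: "ultrafilter_on unit_interval U" and "nonprincipal_near 1 U"
  shows "cls U T_G = cls U T_NM" and "distinct (map (cls U) [T_G, T_L, T_P, T_D])"
proof -
  let ?A = "{x \<in> unit_interval. x \<noteq> 1 \<and> \<bar>x - 1\<bar> < 1/2}"
  have A: "?A \<in> U"
    using assms by (intro punctured_neighbourhood_in_ultrafilter) auto
  have "\<forall>x\<in>?A. \<forall>y\<in>?A. T_G (x, y) = T_NM (x, y)"
    by (auto simp: operation_defs)
  with A show "cls U T_G = cls U T_NM"
    using cls_eq_iff[OF U, of T_G T_NM] unfolding CT_def by blast
  have chain: "T_D (x, x) < T_L (x, x) \<and> T_L (x, x) < T_P (x, x) \<and> T_P (x, x) < T_G (x, x)"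
    if "x \<in> ?A" for x
  proof -
    from that have x: "1/2 < x" "x < 1" by auto
    \<comment> \<open>The gap between \<open>x\<^sup>2\<close> and \<open>2x - 1\<close> is \<open>(1 - x)\<^sup>2\<close>, and \<open>x - x\<^sup>2 = x (1 - x)\<close>.\<close>
    have "0 < (1 - x) * (1 - x)" "0 < x * (1 - x)"
      using x by simp_all
    then show ?thesis
      using x by (simp add: operation_defs algebra_simps)
  qed
  have neq: "cls U S \<noteq> cls U T"
    if "S \<in> CT" "T \<in> CT" "\<And>x. x \<in> ?A \<Longrightarrow> T (x, x) < S (x, x)" for S T
    using less_imp_neq[OF that(3)] by (intro cls_neqI[OF U that(1,2) A]) metis
  have mem: "T_G \<in> CT" "T_L \<in> CT" "T_P \<in> CT" "T_D \<in> CT"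
    by (simp_all add: CT_def)
  have "cls U T_G \<noteq> cls U T_L" "cls U T_G \<noteq> cls U T_P" "cls U T_G \<noteq> cls U T_D"
    "cls U T_L \<noteq> cls U T_D" "cls U T_P \<noteq> cls U T_L" "cls U T_P \<noteq> cls U T_D"
    by (rule neq; (rule mem | drule chain, elim conjE, linarith))+
  then show "distinct (map (cls U) [T_G, T_L, T_P, T_D])" by auto
qed

lemma classes_near_0:
  assumes U: "ultrafilter_on unit_interval U" and "nonprincipal_near 0 U"
  shows "cls U T_L = cls U T_NM" "cls U T_NM = cls U T_D"
    and "distinct (map (cls U) [T_L, T_G, T_P])"
proof -
  let ?A = "{x \<in> unit_interval. x \<noteq> 0 \<and> \<bar>x - 0\<bar> < 1/2}"
  have A: "?A \<in> U"
    using assms by (intro punctured_neighbourhood_in_ultrafilter) auto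
  have "\<forall>x\<in>?A. \<forall>y\<in>?A. T_L (x, y) = T_NM (x, y)" "\<forall>x\<in>?A. \<forall>y\<in>?A. T_NM (x, y) = T_D (x, y)"
    by (auto simp: operation_defs max_def)
  with A show "cls U T_L = cls U T_NM" "cls U T_NM = cls U T_D"
    using cls_eq_iff[OF U, of T_L T_NM] cls_eq_iff[OF U, of T_NM T_D]
    unfolding CT_def by blast+
  have chain: "T_L (x, x) < T_P (x, x) \<and> T_P (x, x) < T_G (x, x)" if "x \<in> ?A" for x
  proof -
    from that have x: "0 < x" "x < 1/2" by auto
    have "0 < x * x" "0 < x * (1 - x)"
      using x by simp_all
    then show ?thesis
      using x by (simp add: operation_defs algebra_simps)
  qed
  have neq: "cls U S \<noteq> cls U T"
    if "S \<in> CT" "T \<in> CT" "\<And>x. x \<in> ?A \<Longrightarrow> T (x, x) < S (x, x)" for S T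
    using less_imp_neq[OF that(3)] by (intro cls_neqI[OF U that(1,2) A]) metis
  have mem: "T_G \<in> CT" "T_L \<in> CT" "T_P \<in> CT"
    by (simp_all add: CT_def)
  have "cls U T_G \<noteq> cls U T_L" "cls U T_G \<noteq> cls U T_P" "cls U T_P \<noteq> cls U T_L"
    by (rule neq; (rule mem | drule chain, elim conjE, linarith))+
  then show "distinct (map (cls U) [T_L, T_G, T_P])" by auto
qed

section \<open>Classification\<close>

theorem theorem9p3:
  fixes U :: "real set set"
  assumes "ultrafilter_on unit_interval U"
  shows "(nonprincipal_near 1 U \<longrightarrow>
      cls U T_G = cls U T_NM \<and>
      (\<exists>Fo Fa. cat_isomorphism (CTNorm U)
                 (discrete_category {Min_label, Lin_label, Prod_label, Dr_label}) Fo Fa \<and>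
               Fo (cls U T_G) = Min_label \<and> Fo (cls U T_L) = Lin_label \<and>
               Fo (cls U T_P) = Prod_label \<and> Fo (cls U T_D) = Dr_label)) \<and>
    (nonprincipal_near 0 U \<longrightarrow>
      cls U T_L = cls U T_NM \<and> cls U T_NM = cls U T_D \<and>
      (\<exists>Fo Fa. cat_isomorphism (CTNorm U)
                 (discrete_category {Zero_label, Min_label, Prod_label}) Fo Fa \<and>
               Fo (cls U T_L) = Zero_label \<and> Fo (cls U T_G) = Min_label \<and>
               Fo (cls U T_P) = Prod_label)) \<and>
    finite_category (CTNorm U) \<and> card (Ob (CTNorm U)) \<le> 5"
proof (intro conjI impI)
  assume near: "nonprincipal_near 1 U"
  note cl = classes_near_1[OF assms near]
  show "cls U T_G = cls U T_NM" by (fact cl(1))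
  define F where "F c = (if c = cls U T_G then Min_label else if c = cls U T_L then Lin_label
    else if c = cls U T_P then Prod_label else Dr_label)" for c
  have F: "F (cls U T_G) = Min_label" "F (cls U T_L) = Lin_label"
    "F (cls U T_P) = Prod_label" "F (cls U T_D) = Dr_label"
    unfolding F_def using cl(2) by (simp_all add: eq_commute)
  have "CT // sim_CT U = {cls U T_G, cls U T_L, cls U T_P, cls U T_D}"
    unfolding CT_quotient unfolding CT_def by (simp add: insert_commute flip: cl(1))
  then have "bij_betw F (CT // sim_CT U) {Min_label, Lin_label, Prod_label, Dr_label}"
    unfolding bij_betw_def inj_on_def by (simp add: F)
  then have "cat_isomorphism (CTNorm U)
      (discrete_category {Min_label, Lin_label, Prod_label, Dr_label}) F (map_ident F)"
    unfolding CTNorm_def by (rule cat_isomorphism_discrete_category)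
  then show "\<exists>Fo Fa. cat_isomorphism (CTNorm U)
        (discrete_category {Min_label, Lin_label, Prod_label, Dr_label}) Fo Fa \<and>
      Fo (cls U T_G) = Min_label \<and> Fo (cls U T_L) = Lin_label \<and>
      Fo (cls U T_P) = Prod_label \<and> Fo (cls U T_D) = Dr_label"
    using F by blast
next
  assume near: "nonprincipal_near 0 U"
  note cl = classes_near_0[OF assms near]
  show "cls U T_L = cls U T_NM" "cls U T_NM = cls U T_D" by (fact cl)+
  define F where "F c = (if c = cls U T_L then Zero_label else if c = cls U T_G then Min_label
    else Prod_label)" for c
  have F: "F (cls U T_L) = Zero_label" "F (cls U T_G) = Min_label" "F (cls U T_P) = Prod_label"
    unfolding F_def using cl(3) by (simp_all add: eq_commute)
  have "CT // sim_CT U = {cls U T_L, cls U T_G, cls U T_P}"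
    unfolding CT_quotient unfolding CT_def by (simp add: insert_commute cl(1) flip: cl(2))
  then have "bij_betw F (CT // sim_CT U) {Zero_label, Min_label, Prod_label}"
    unfolding bij_betw_def inj_on_def by (simp add: F)
  then have "cat_isomorphism (CTNorm U)
      (discrete_category {Zero_label, Min_label, Prod_label}) F (map_ident F)"
    unfolding CTNorm_def by (rule cat_isomorphism_discrete_category)
  then show "\<exists>Fo Fa. cat_isomorphism (CTNorm U)
        (discrete_category {Zero_label, Min_label, Prod_label}) Fo Fa \<and>
      Fo (cls U T_L) = Zero_label \<and> Fo (cls U T_G) = Min_label \<and>
      Fo (cls U T_P) = Prod_label"
    using F by blast
next
  show "finite_category (CTNorm U)"
    unfolding CTNorm_def CT_quotient
    by (rule finite_category_discrete_category) (simp add: CT_def)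
next
  have "CT = set [T_G, T_L, T_P, T_NM, T_D]"
    by (simp add: CT_def)
  then have "card CT \<le> 5"
    using card_length[of "[T_G, T_L, T_P, T_NM, T_D]"] by simp
  moreover have "card (cls U ` CT) \<le> card CT"
    by (rule card_image_le) (simp add: CT_def)
  ultimately show "card (Ob (CTNorm U)) \<le> 5"
    by (simp add: Ob_CTNorm)
qed

end
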